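(* Let $G$, $\mathcal{G}$, the upper layer $l$, the class $i$ and the helper graph $\mathcal{H}_i$ be as in the context, and suppose every virtual node of layer $l$ knows the class and component identifier of each of its old neighbors. Then, in the V-CONGEST model on $G$, where each real node simulates its two virtual copies on layer $l$, the helper graph $\mathcal{H}_i$ can be constructed in $O(\Delta)$ rounds by the following protocol: every type-2 node $v$ that adds a node $v_{\mathcal{C}}$ sends the class $i$ and the identifier of $\mathcal{C}$ to its type-1 neighbors; every type-1 node $w$ receiving such a message checks whether it has no neighbor in $\mathcal{C}$ and a neighbor in another component of class $i$, and if so adds $w_{\mathcal{C}}$ and the edge $\{v_{\mathcal{C}},w_{\mathcal{C}}\}$ and responds to that message.
   Context: $G=(V,E)$ is a finite undirected graph on $n$ nodes with maximum degree $\Delta$. Fix an integer $L$. The virtual graph $\mathcal{G}$ contains $3L$ copies of each $v\in V$: each lower layer $1,\dots,L$ contains one copy of every node; each upper layer $L+1,\dots,2L$ contains a type-1 copy and a type-2 copy of every node. Every copy of $v$ is adjacent to all other copies of $v$ and to all copies of each neighbor of $v$ in $G$. $\Psi$ maps virtual nodes to the corresponding real nodes. There are classes $1,\dots,t$. For a fixed upper layer $l$, the nodes of layers $1,\dots,l-1$ are old nodes, each assigned a class; a component of class $i$ is a connected component of the subgraph of $\mathcal{G}$ induced by the old nodes of class $i$. The helper graph $\mathcal{H}_i[\mathcal{C}]$ for a component $\mathcal{C}$ of class $i$: for each type-2 node $v$ of layer $l$, a node $v_{\mathcal{C}}$ is added iff $\Psi(v)\notin\Psi(\mathcal{C})$,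 $v$ has a neighbor in $\mathcal{C}$, and $v$ has no neighbor in another component of class $i$; for each such $v_{\mathcal{C}}$ and each type-1 neighbor $w$ of $v$ on layer $l$ that has a neighbor in some component $\mathcal{C}'\neq\mathcal{C}$ of class $i$ but no neighbor in $\mathcal{C}$, a node $w_{\mathcal{C}}$ and edge $\{v_{\mathcal{C}},w_{\mathcal{C}}\}$ are added. $\mathcal{H}_i$ is the disjoint union of all $\mathcal{H}_i[\mathcal{C}]$. V-CONGEST model: synchronous rounds in which each node may send one identical message of $O(\log n)$ bits to all its neighbors in $G$. *)

theory Defs
  imports Main
begin

text \<open>A virtual node is a triple (v, j, k): real node v, layer j, type k.
  Lower layers 1..L carry one copy of type 0; upper layers L+1..2L carry a
  type-1 and a type-2 copy.\<close>

type_synonym 'v vnode = "'v \<times> nat \<times> nat"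

definition Psi :: "'v vnode \<Rightarrow> 'v" where "Psi x = fst x"
definition layer :: "'v vnode \<Rightarrow> nat" where "layer x = fst (snd x)"
definition vtype :: "'v vnode \<Rightarrow> nat" where "vtype x = snd (snd x)"

definition vnodes :: "'v set \<Rightarrow> nat \<Rightarrow> 'v vnode set" where
  "vnodes V L =
     {(v, j, 0) | v j. v \<in> V \<and> 1 \<le> j \<and> j \<le> L} \<union>
     {(v, j, k) | v j k. v \<in> V \<and> L < j \<and> j \<le> 2 * L \<and> k \<in> {1, 2}}"

definition vadj :: "('v \<Rightarrow> 'v \<Rightarrow> bool) \<Rightarrow> 'v vnode \<Rightarrow> 'v vnode \<Rightarrow> bool" where
  "vadj E x y \<longleftrightarrow> x \<noteq> y \<and> (Psi x = Psi y \<or> E (Psi x) (Psi y))"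

definition old :: "'v set \<Rightarrow> nat \<Rightarrow> nat \<Rightarrow> 'v vnode set" where
  "old V L l = {x \<in> vnodes V L. layer x < l}"

definition class_set ::
  "'v set \<Rightarrow> nat \<Rightarrow> nat \<Rightarrow> ('v vnode \<Rightarrow> nat) \<Rightarrow> nat \<Rightarrow> 'v vnode set" where
  "class_set V L l cls i = {x \<in> old V L l. cls x = i}"

definition comp_in ::
  "('v \<Rightarrow> 'v \<Rightarrow> bool) \<Rightarrow> 'v vnode set \<Rightarrow> 'v vnode \<Rightarrow> 'v vnode set" where
  "comp_in E S x = {y. (x, y) \<in> {(a, b). a \<in> S \<and> b \<in> S \<and> vadj E a b}\<^sup>*}"

definition components ::
  "'v set \<Rightarrow> ('v \<Rightarrow> 'v \<Rightarrow> bool) \<Rightarrow> nat \<Rightarrow> nat \<Rightarrow> ('v vnode \<Rightarrow> nat) \<Rightarrow> nat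
     \<Rightarrow> 'v vnode set set" where
  "components V E L l cls i =
     (\<lambda>x. comp_in E (class_set V L l cls i) x) ` class_set V L l cls i"

definition adj_to :: "('v \<Rightarrow> 'v \<Rightarrow> bool) \<Rightarrow> 'v vnode \<Rightarrow> 'v vnode set \<Rightarrow> bool" where
  "adj_to E x C \<longleftrightarrow> (\<exists>u\<in>C. vadj E x u)"

definition hv2 ::
  "'v set \<Rightarrow> ('v \<Rightarrow> 'v \<Rightarrow> bool) \<Rightarrow> nat \<Rightarrow> nat \<Rightarrow> ('v vnode \<Rightarrow> nat) \<Rightarrow> nat
     \<Rightarrow> 'v vnode set \<Rightarrow> 'v vnode \<Rightarrow> bool" where
  "hv2 V E L l cls i C v \<longleftrightarrow>
     v \<in> vnodes V L \<and> layer v = l \<and> vtype v = 2 \<and>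
     Psi v \<notin> Psi ` C \<and> adj_to E v C \<and>
     \<not> (\<exists>C' \<in> components V E L l cls i. C' \<noteq> C \<and> adj_to E v C')"

definition hedge ::
  "'v set \<Rightarrow> ('v \<Rightarrow> 'v \<Rightarrow> bool) \<Rightarrow> nat \<Rightarrow> nat \<Rightarrow> ('v vnode \<Rightarrow> nat) \<Rightarrow> nat
     \<Rightarrow> 'v vnode set \<Rightarrow> 'v vnode \<Rightarrow> 'v vnode \<Rightarrow> bool" where
  "hedge V E L l cls i C v w \<longleftrightarrow>
     hv2 V E L l cls i C v \<and>
     w \<in> vnodes V L \<and> layer w = l \<and> vtype w = 1 \<and> vadj E v w \<and>
     (\<exists>C' \<in> components V E L l cls i. C' \<noteq> C \<and> adj_to E w C') \<and>
     \<not> adj_to E w C"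

definition hv1 ::
  "'v set \<Rightarrow> ('v \<Rightarrow> 'v \<Rightarrow> bool) \<Rightarrow> nat \<Rightarrow> nat \<Rightarrow> ('v vnode \<Rightarrow> nat) \<Rightarrow> nat
     \<Rightarrow> 'v vnode set \<Rightarrow> 'v vnode \<Rightarrow> bool" where
  "hv1 V E L l cls i C w \<longleftrightarrow> (\<exists>v. hedge V E L l cls i C v w)"

text \<open>H_i is the disjoint union of the H_i[C]; a helper node x_C is encoded
  as the pair (x, C).\<close>
definition helper_nodes ::
  "'v set \<Rightarrow> ('v \<Rightarrow> 'v \<Rightarrow> bool) \<Rightarrow> nat \<Rightarrow> nat \<Rightarrow> ('v vnode \<Rightarrow> nat) \<Rightarrow> nat
     \<Rightarrow> ('v vnode \<times> 'v vnode set) set" where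
  "helper_nodes V E L l cls i =
     {(x, C). C \<in> components V E L l cls i \<and>
              (hv2 V E L l cls i C x \<or> hv1 V E L l cls i C x)}"

definition helper_edges ::
  "'v set \<Rightarrow> ('v \<Rightarrow> 'v \<Rightarrow> bool) \<Rightarrow> nat \<Rightarrow> nat \<Rightarrow> ('v vnode \<Rightarrow> nat) \<Rightarrow> nat
     \<Rightarrow> (('v vnode \<times> 'v vnode set) \<times> ('v vnode \<times> 'v vnode set)) set" where
  "helper_edges V E L l cls i =
     {((v, C), (w, C)) | v w C. C \<in> components V E L l cls i \<and>
                                hedge V E L l cls i C v w}"

text \<open>Local input of a real node u: its own identifier, the class i, and for
  every old neighbour x of its layer-l copies the tuple
  (identifier of Psi x, layer x, type x, class of x, component identifier of x).\<close>
type_synonym inp = "nat \<times> nat \<times> (nat \<times> nat \<times> nat \<times> nat \<times> nat) set"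

text \<open>History of a node: for each past round, the set of (sender id, message)
  pairs received from its neighbours in G.\<close>
type_synonym hist = "(nat \<times> nat) set list"

text \<open>Local output of a real node u: the helper nodes hosted by its layer-l
  copies, as pairs (type, component identifier), and the helper edges incident to
  them, as triples (type of own copy, component identifier, identifier of the
  real node hosting the other endpoint).\<close>
type_synonym outp = "(nat \<times> nat) set \<times> (nat \<times> nat \<times> nat) set"

primrec run ::
  "('v \<Rightarrow> 'v \<Rightarrow> bool) \<Rightarrow> ('v \<Rightarrow> nat) \<Rightarrow> ('v \<Rightarrow> inp) \<Rightarrow> (inp \<Rightarrow> hist \<Rightarrow> nat option)
     \<Rightarrow> nat \<Rightarrow> 'v \<Rightarrow> hist" where
  "run E ident I msg 0 = (\<lambda>u. [])"
| "run E ident I msg (Suc r) =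
     (\<lambda>u. run E ident I msg r u @
          [{(ident w, m) | w m. E u w \<and> msg (I w) (run E ident I msg r w) = Some m}])"

definition degree :: "'v set \<Rightarrow> ('v \<Rightarrow> 'v \<Rightarrow> bool) \<Rightarrow> 'v \<Rightarrow> nat" where
  "degree V E u = card {w \<in> V. E u w}"

definition max_degree :: "'v set \<Rightarrow> ('v \<Rightarrow> 'v \<Rightarrow> bool) \<Rightarrow> nat" where
  "max_degree V E = Max (insert 0 (degree V E ` V))"

definition local_input ::
  "'v set \<Rightarrow> ('v \<Rightarrow> 'v \<Rightarrow> bool) \<Rightarrow> nat \<Rightarrow> nat \<Rightarrow> ('v vnode \<Rightarrow> nat)
     \<Rightarrow> ('v vnode \<Rightarrow> nat) \<Rightarrow> ('v \<Rightarrow> nat) \<Rightarrow> nat \<Rightarrow> 'v \<Rightarrow> inp" where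
  "local_input V E L l cls cid ident i u =
     (ident u, i,
      {(ident (Psi x), layer x, vtype x, cls x, cid x) | x.
         x \<in> old V L l \<and> vadj E (u, l, 1) x})"

definition local_output ::
  "'v set \<Rightarrow> ('v \<Rightarrow> 'v \<Rightarrow> bool) \<Rightarrow> nat \<Rightarrow> nat \<Rightarrow> ('v vnode \<Rightarrow> nat)
     \<Rightarrow> ('v vnode \<Rightarrow> nat) \<Rightarrow> ('v \<Rightarrow> nat) \<Rightarrow> nat \<Rightarrow> 'v \<Rightarrow> outp" where
  "local_output V E L l cls cid ident i u =
     ({(k, c) | k c. \<exists>C x. ((u, l, k), C) \<in> helper_nodes V E L l cls i \<and>
                           x \<in> C \<and> cid x = c},
      {(2, c, ident (Psi w)) | c w. \<exists>C x.
           (((u, l, 2), C), (w, C)) \<in> helper_edges V E L l cls i \<and> x \<in> C \<and> cid x = c} \<union>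
      {(1, c, ident (Psi v)) | c v. \<exists>C x.
           ((v, C), ((u, l, 1), C)) \<in> helper_edges V E L l cls i \<and> x \<in> C \<and> cid x = c})"

end

theory Submission
  imports Defs
begin

text \<open>Every real node u reads off its input the set A(u) of identifiers of class-i components
  adjacent to its layer-l copies, together with one bit per component telling whether u itself
  has a copy in it, i.e. whether \<open>\<Psi>(u) \<in> \<Psi>(C)\<close>. Component identifiers are constant on the copies of
  one real node, so |A(u)| is at most deg(u) + 1, and broadcasting A(u) one element per round,
  with the bit as lowest binary digit, takes at most \<open>\<Delta> + 1\<close> rounds. Afterwards every node knows A
  and the bits of all its neighbours, and that is all the definition of \<open>\<H>\<^sub>i\<close> refers to: u hosts
  \<open>v\<^sub>C\<close> iff A(u) = {c} with clear bit, and u hosts \<open>w\<^sub>C\<close>, joined to \<open>v\<^sub>C\<close> of a neighbour v, iff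
  v hosts \<open>v\<^sub>C\<close>, c \<notin> A(u) and A(u) contains another component. Broadcasting all of A(u)
  subsumes the announce-and-respond exchange of the paper within the same round bound.\<close>

lemma length_run [simp]: "length (run E ident I msg r u) = r"
  by (induction r arbitrary: u) auto

lemma Union_run:
  "\<Union>(set (run E ident I msg r u)) =
     {(ident w, m) | w m. E u w \<and> (\<exists>j<r. msg (I w) (run E ident I msg j w) = Some m)}"
proof (induction r arbitrary: u)
  case (Suc r)
  then show ?case by (auto simp: less_Suc_eq)
qed simp

lemma card_image_le_card_image:
  assumes "finite (g ` Y)" and "\<And>x y. x \<in> Y \<Longrightarrow> y \<in> Y \<Longrightarrow> g x = g y \<Longrightarrow> f x = f y"
  shows "finite (f ` Y)" and "card (f ` Y) \<le> card (g ` Y)"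
proof -
  define h where "h p = f (SOME x. x \<in> Y \<and> g x = p)" for p
  have "h (g x) = f x" if "x \<in> Y" for x
    using someI_ex[of "\<lambda>y. y \<in> Y \<and> g y = g x"] that assms(2) unfolding h_def by blast
  then have "f ` Y = h ` g ` Y" by (auto simp: image_image)
  then show "finite (f ` Y)" and "card (f ` Y) \<le> card (g ` Y)"
    using assms(1) by (simp_all add: card_image_le)
qed

lemma Psi_layer_vtype [simp]: "Psi (z, j, k) = z" "layer (z, j, k) = j" "vtype (z, j, k) = k"
  by (simp_all add: Psi_def layer_def vtype_def)

lemma old_D: "x \<in> old V L l \<Longrightarrow> Psi x \<in> V \<and> layer x < l"
  unfolding old_def vnodes_def by auto

lemma class_set_D: "x \<in> class_set V L l cls i \<Longrightarrow> x \<in> old V L l \<and> cls x = i"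
  unfolding class_set_def by auto

lemma comp_in_subset: "x \<in> T \<Longrightarrow> comp_in E T x \<subseteq> T"
proof
  fix y assume "x \<in> T" "y \<in> comp_in E T x"
  then have "(x, y) \<in> {(a, b). a \<in> T \<and> b \<in> T \<and> vadj E a b}\<^sup>*" and "x \<in> T"
    unfolding comp_in_def by simp_all
  then show "y \<in> T" by (induction rule: rtrancl_induct) auto
qed

lemma helper_edges_iff:
  "((v, C), (w, C)) \<in> helper_edges V E L l cls i \<longleftrightarrow>
    C \<in> components V E L l cls i \<and> hedge V E L l cls i C v w"
  unfolding helper_edges_def by blast

text \<open>The lower copies of u are old neighbours of its layer-l copy and carry u's identifier,
  which is how \<open>input_hosts\<close> decides \<open>\<Psi>(u) \<in> \<Psi>(C)\<close>.\<close>

definition input_comps :: "inp \<Rightarrow> nat set" where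
  "input_comps p = {c. \<exists>a b t. (a, b, t, fst (snd p), c) \<in> snd (snd p)}"

definition input_hosts :: "inp \<Rightarrow> nat \<Rightarrow> bool" where
  "input_hosts p c \<longleftrightarrow> (\<exists>b t. (fst p, b, t, fst (snd p), c) \<in> snd (snd p))"

definition encode :: "inp \<Rightarrow> nat \<Rightarrow> nat" where
  "encode p c = 2 * c + (if input_hosts p c then 1 else 0)"

definition helper_msg :: "inp \<Rightarrow> hist \<Rightarrow> nat option" where
  "helper_msg p h =
     (let cs = sorted_list_of_set (input_comps p)
      in if length h < length cs then Some (encode p (cs ! length h)) else None)"

lemma encode_div_2 [simp]: "encode p c div 2 = c"
  by (simp add: encode_def)

lemma encode_eq_double_iff: "encode p c = 2 * c' \<longleftrightarrow> c' = c \<and> \<not> input_hosts p c"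
  unfolding encode_def by (cases "input_hosts p c") presburger+

lemma encode_le: "encode p c \<le> 2 * c + 1"
  by (simp add: encode_def)

lemma helper_msg_SomeD:
  "helper_msg p h = Some m \<Longrightarrow> \<exists>c\<in>input_comps p. m = encode p c"
proof -
  let ?cs = "sorted_list_of_set (input_comps p)"
  assume "helper_msg p h = Some m"
  then have "length h < length ?cs" "m = encode p (?cs ! length h)"
    by (auto simp: helper_msg_def Let_def split: if_splits)
  moreover have "finite (input_comps p)"
    using calculation(1) by (metis length_sorted_list_of_set card.infinite not_less0)
  ultimately show ?thesis by (metis nth_mem set_sorted_list_of_set)
qed

lemma helper_msgs_sent:
  assumes "finite (input_comps p)" "card (input_comps p) \<le> r"
  shows "{m. \<exists>j<r. helper_msg p (run E ident I helper_msg j u) = Some m} = encode p ` input_comps p"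
proof -
  let ?cs = "sorted_list_of_set (input_comps p)"
  have "{m. \<exists>j<r. helper_msg p (run E ident I helper_msg j u) = Some m} = encode p ` set ?cs"
    using assms(2) by (force simp: helper_msg_def in_set_conv_nth)
  then show ?thesis using assms(1) by simp
qed

definition input_type2 :: "inp \<Rightarrow> nat \<Rightarrow> bool" where
  "input_type2 p c \<longleftrightarrow> input_comps p = {c} \<and> \<not> input_hosts p c"

definition heard_comps :: "(nat \<times> nat) set \<Rightarrow> nat \<Rightarrow> nat set" where
  "heard_comps R s = {m div 2 | m. (s, m) \<in> R}"

definition heard_type2 :: "(nat \<times> nat) set \<Rightarrow> nat \<Rightarrow> nat \<Rightarrow> bool" where
  "heard_type2 R s c \<longleftrightarrow> heard_comps R s = {c} \<and> (s, 2 * c) \<in> R"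

definition receptive :: "nat set \<Rightarrow> nat \<Rightarrow> bool" where
  "receptive X c \<longleftrightarrow> c \<notin> X \<and> (\<exists>c'\<in>X. c' \<noteq> c)"

definition helper_out :: "inp \<Rightarrow> hist \<Rightarrow> outp" where
  "helper_out p h =
     (let R = \<Union>(set h) in
      ({(2, c) | c. input_type2 p c} \<union>
       {(1, c) | c. (\<exists>s. heard_type2 R s c) \<and> receptive (input_comps p) c},
       {(2, c, s) | c s. input_type2 p c \<and> receptive (heard_comps R s) c} \<union>
       {(1, c, s) | c s. heard_type2 R s c \<and> receptive (input_comps p) c}))"

locale helper_setup =
  fixes V :: "'v set" and E :: "'v \<Rightarrow> 'v \<Rightarrow> bool" and L l i :: nat
    and cls cid :: "'v vnode \<Rightarrow> nat" and ident :: "'v \<Rightarrow> nat"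
  assumes finite_V: "finite V"
    and edge_in_V: "E u w \<Longrightarrow> u \<in> V \<and> w \<in> V"
    and sym_E: "E u w \<Longrightarrow> E w u"
    and upper_layer: "L < l" "l \<le> 2 * L"
    and cid_iff_comp_in: "\<lbrakk>x \<in> old V L l; y \<in> old V L l; cls x = cls y\<rbrakk> \<Longrightarrow>
          cid x = cid y \<longleftrightarrow> y \<in> comp_in E (class_set V L l cls (cls x)) x"
    and inj_ident: "inj_on ident V"
begin

abbreviation S :: "'v vnode set" where
  "S \<equiv> class_set V L l cls i"

abbreviation I :: "'v \<Rightarrow> inp" where
  "I \<equiv> local_input V E L l cls cid ident i"

definition comp_with_id :: "nat \<Rightarrow> 'v vnode set" where
  "comp_with_id c = {x \<in> S. cid x = c}"

text \<open>Both layer-l copies of u have the same old neighbours (\<open>vadj_layer_l_iff\<close>), so the type-1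
  copy stands for both.\<close>

definition adj_comps :: "'v \<Rightarrow> nat set" where
  "adj_comps u = cid ` {x \<in> S. vadj E (u, l, 1) x}"

definition hosts :: "'v \<Rightarrow> nat \<Rightarrow> bool" where
  "hosts u c \<longleftrightarrow> (\<exists>x\<in>S. Psi x = u \<and> cid x = c)"

definition type2_helper :: "'v \<Rightarrow> nat \<Rightarrow> bool" where
  "type2_helper u c \<longleftrightarrow> adj_comps u = {c} \<and> \<not> hosts u c"

lemma layer_l_vnodes_iff:
  "v \<in> vnodes V L \<and> layer v = l \<and> vtype v = k \<longleftrightarrow> k \<in> {1, 2} \<and> (\<exists>z\<in>V. v = (z, l, k))"
  using upper_layer unfolding vnodes_def layer_def vtype_def by auto

lemma input_comps_local_input: "input_comps (I u) = adj_comps u"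
  unfolding input_comps_def local_input_def adj_comps_def class_set_def by force

lemma input_hosts_local_input:
  assumes "u \<in> V" shows "input_hosts (I u) c \<longleftrightarrow> hosts u c"
proof
  assume "input_hosts (I u) c"
  then obtain x where x: "x \<in> old V L l" "ident (Psi x) = ident u" "cls x = i" "cid x = c"
    unfolding input_hosts_def local_input_def by auto
  then have "Psi x = u" using old_D[OF x(1)] assms inj_ident by (auto dest: inj_onD)
  then show "hosts u c" using x unfolding hosts_def class_set_def by blast
next
  assume "hosts u c"
  then obtain x where x: "x \<in> S" "Psi x = u" "cid x = c" unfolding hosts_def by auto
  then have "layer x < l" using old_D class_set_D by blast
  then have "(u, l, 1) \<noteq> x" by auto
  then have "vadj E (u, l, 1) x" using x(2) unfolding vadj_def by simp
  then show "input_hosts (I u) c"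
    using x class_set_D[OF x(1)] unfolding input_hosts_def local_input_def
    by (cases x) (auto simp: Psi_def)
qed

lemma input_type2_local_input: "u \<in> V \<Longrightarrow> input_type2 (I u) c \<longleftrightarrow> type2_helper u c"
  by (simp add: input_type2_def type2_helper_def input_comps_local_input input_hosts_local_input)

lemma comp_in_eq_comp_with_id:
  assumes "x \<in> S" shows "comp_in E S x = comp_with_id (cid x)"
proof -
  have "cls x = i" "x \<in> old V L l" using class_set_D[OF assms] by simp_all
  then have cid_iff: "y \<in> S \<Longrightarrow> cid x = cid y \<longleftrightarrow> y \<in> comp_in E S x" for y
    using cid_iff_comp_in[of x y] class_set_D[of y V L l cls i] by simp
  show ?thesis
  proof (intro set_eqI iffI)
    fix y assume y: "y \<in> comp_in E S x"
    have "y \<in> S" using comp_in_subset[OF assms] y by (rule subsetD)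
    with y cid_iff[of y] show "y \<in> comp_with_id (cid x)" unfolding comp_with_id_def by simp
  next
    fix y assume "y \<in> comp_with_id (cid x)"
    with cid_iff[of y] show "y \<in> comp_in E S x" unfolding comp_with_id_def by simp
  qed
qed

lemma components_eq: "components V E L l cls i = comp_with_id ` cid ` S"
  unfolding components_def image_image by (rule image_cong) (simp_all add: comp_in_eq_comp_with_id)

lemma cid_eq_if_Psi_eq:
  assumes "x \<in> S" "y \<in> S" "Psi x = Psi y" shows "cid x = cid y"
proof (cases "x = y")
  case False
  then have "y \<in> comp_in E S x" using assms unfolding comp_in_def vadj_def by auto
  then show ?thesis using comp_in_eq_comp_with_id[OF assms(1)] unfolding comp_with_id_def by auto
qed simp

lemma adj_comps_subset: "adj_comps u \<subseteq> cid ` S"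
  unfolding adj_comps_def by auto

lemma comp_with_id_eq_iff: "c \<in> cid ` S \<Longrightarrow> comp_with_id c = comp_with_id c' \<longleftrightarrow> c = c'"
  unfolding comp_with_id_def by auto

lemma vadj_layer_l_iff:
  "\<lbrakk>layer v = l; y \<in> old V L l\<rbrakk> \<Longrightarrow> vadj E v y \<longleftrightarrow> vadj E (Psi v, l, 1) y"
  using old_D unfolding vadj_def by (metis Psi_layer_vtype(1,2) less_irrefl)

lemma adj_to_comp_with_id_iff:
  assumes "layer v = l" shows "adj_to E v (comp_with_id c) \<longleftrightarrow> c \<in> adj_comps (Psi v)"
proof -
  have "vadj E v y \<longleftrightarrow> vadj E (Psi v, l, 1) y" if "y \<in> S" for y
    using vadj_layer_l_iff[OF assms] class_set_D that by blast
  then show ?thesis unfolding adj_to_def comp_with_id_def adj_comps_def by blast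
qed

lemma adj_to_other_component_iff:
  assumes "layer w = l"
  shows "(\<exists>C'\<in>components V E L l cls i. C' \<noteq> comp_with_id c \<and> adj_to E w C') \<longleftrightarrow>
    (\<exists>c'\<in>adj_comps (Psi w). c' \<noteq> c)"
proof
  assume "\<exists>C'\<in>components V E L l cls i. C' \<noteq> comp_with_id c \<and> adj_to E w C'"
  then obtain C' where C': "C' \<in> comp_with_id ` cid ` S" "C' \<noteq> comp_with_id c" "adj_to E w C'"
    unfolding components_eq by blast
  then obtain c' where "C' = comp_with_id c'" by blast
  with C' have "c' \<in> adj_comps (Psi w)" "c' \<noteq> c"
    using adj_to_comp_with_id_iff[OF assms] by auto
  then show "\<exists>c'\<in>adj_comps (Psi w). c' \<noteq> c" by blast
next
  assume "\<exists>c'\<in>adj_comps (Psi w). c' \<noteq> c"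
  then obtain c' where c': "c' \<in> adj_comps (Psi w)" "c' \<noteq> c" by blast
  then have "c' \<in> cid ` S" using adj_comps_subset by blast
  then have "comp_with_id c' \<in> components V E L l cls i" "comp_with_id c' \<noteq> comp_with_id c"
    using c'(2) comp_with_id_eq_iff unfolding components_eq by simp_all
  moreover have "adj_to E w (comp_with_id c')" using adj_to_comp_with_id_iff[OF assms] c'(1) by simp
  ultimately show "\<exists>C'\<in>components V E L l cls i. C' \<noteq> comp_with_id c \<and> adj_to E w C'" by blast
qed

lemma Psi_in_Psi_image_comp_with_id_iff: "u \<in> Psi ` comp_with_id c \<longleftrightarrow> hosts u c"
  unfolding hosts_def comp_with_id_def by blast

lemma hv2_comp_with_id_iff:
  "hv2 V E L l cls i (comp_with_id c) v \<longleftrightarrow> (\<exists>z\<in>V. v = (z, l, 2) \<and> type2_helper z c)"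
proof -
  have "hv2 V E L l cls i (comp_with_id c) v \<longleftrightarrow>
      v \<in> vnodes V L \<and> layer v = l \<and> vtype v = 2 \<and> type2_helper (Psi v) c"
    unfolding hv2_def type2_helper_def Psi_in_Psi_image_comp_with_id_iff
    using adj_to_comp_with_id_iff[of v c] adj_to_other_component_iff[of v c] by auto
  then show ?thesis using layer_l_vnodes_iff[of v 2] by (metis Psi_layer_vtype(1) insertCI)
qed

lemma hedge_comp_with_id_iff:
  "hedge V E L l cls i (comp_with_id c) v w \<longleftrightarrow>
    (\<exists>z u. v = (z, l, 2) \<and> w = (u, l, 1) \<and> E z u \<and> type2_helper z c \<and> receptive (adj_comps u) c)"
proof -
  have "hedge V E L l cls i (comp_with_id c) v w \<longleftrightarrow> hv2 V E L l cls i (comp_with_id c) v \<and>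
      (w \<in> vnodes V L \<and> layer w = l \<and> vtype w = 1) \<and> vadj E v w \<and> receptive (adj_comps (Psi w)) c"
    unfolding hedge_def receptive_def
    using adj_to_comp_with_id_iff[of w c] adj_to_other_component_iff[of w c] by blast
  also have "\<dots> \<longleftrightarrow> (\<exists>z\<in>V. v = (z, l, 2) \<and> type2_helper z c) \<and> (\<exists>u\<in>V. w = (u, l, 1)) \<and>
      vadj E v w \<and> receptive (adj_comps (Psi w)) c"
    unfolding hv2_comp_with_id_iff layer_l_vnodes_iff by simp
  also have "\<dots> \<longleftrightarrow>
      (\<exists>z u. v = (z, l, 2) \<and> w = (u, l, 1) \<and> E z u \<and> type2_helper z c \<and> receptive (adj_comps u) c)"
    unfolding vadj_def type2_helper_def receptive_def using edge_in_V by auto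
  finally show ?thesis .
qed

lemma hv1_comp_with_id_iff:
  "hv1 V E L l cls i (comp_with_id c) w \<longleftrightarrow>
    (\<exists>z u. w = (u, l, 1) \<and> E z u \<and> type2_helper z c \<and> receptive (adj_comps u) c)"
  unfolding hv1_def hedge_comp_with_id_iff by blast

lemma type2_helper_cid: "type2_helper z c \<Longrightarrow> c \<in> cid ` S"
  unfolding type2_helper_def using adj_comps_subset by blast

lemma ex_component_with_id_iff:
  "(\<exists>C x. (C \<in> components V E L l cls i \<and> Q C) \<and> x \<in> C \<and> cid x = c) \<longleftrightarrow>
    c \<in> cid ` S \<and> Q (comp_with_id c)"
  unfolding components_eq comp_with_id_def by blast

lemma local_output_eq:
  assumes "u \<in> V"
  shows "local_output V E L l cls cid ident i u =
    ({(2, c) | c. type2_helper u c} \<union>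
     {(1, c) | c. (\<exists>z. E u z \<and> type2_helper z c) \<and> receptive (adj_comps u) c},
     {(2, c, ident w) | c w. E u w \<and> type2_helper u c \<and> receptive (adj_comps w) c} \<union>
     {(1, c, ident z) | c z. E u z \<and> type2_helper z c \<and> receptive (adj_comps u) c})"
proof -
  have nodes: "(\<exists>C x. ((u, l, k), C) \<in> helper_nodes V E L l cls i \<and> x \<in> C \<and> cid x = c) \<longleftrightarrow>
      k = 2 \<and> type2_helper u c \<or>
      k = 1 \<and> (\<exists>z. E u z \<and> type2_helper z c) \<and> receptive (adj_comps u) c" for k c
    unfolding helper_nodes_def mem_Collect_eq case_prod_conv ex_component_with_id_iff
      hv2_comp_with_id_iff hv1_comp_with_id_iff
    using assms sym_E type2_helper_cid by blast
  have edges_out: "(\<exists>C x. (((u, l, 2), C), (w, C)) \<in> helper_edges V E L l cls i \<and> x \<in> C \<and> cid x = c)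
      \<longleftrightarrow> (\<exists>z. w = (z, l, 1) \<and> E u z \<and> type2_helper u c \<and> receptive (adj_comps z) c)" for w c
    unfolding helper_edges_iff ex_component_with_id_iff hedge_comp_with_id_iff
    using type2_helper_cid by blast
  have edges_in: "(\<exists>C x. ((v, C), ((u, l, 1), C)) \<in> helper_edges V E L l cls i \<and> x \<in> C \<and> cid x = c)
      \<longleftrightarrow> (\<exists>z. v = (z, l, 2) \<and> E u z \<and> type2_helper z c \<and> receptive (adj_comps u) c)" for v c
    unfolding helper_edges_iff ex_component_with_id_iff hedge_comp_with_id_iff
    using sym_E type2_helper_cid by blast
  show ?thesis
    unfolding local_output_def nodes edges_out edges_in by auto
qed

text \<open>The copies of u itself count as one more neighbour, whence \<open>\<Delta> + 1\<close>.\<close>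

lemma card_adj_comps_le:
  assumes "u \<in> V"
  shows "finite (adj_comps u)" and "card (adj_comps u) \<le> max_degree V E + 1"
proof -
  let ?Y = "{x \<in> S. vadj E (u, l, 1) x}" and ?N = "insert u {w \<in> V. E u w}"
  have fin_N: "finite ?N" using finite_V by simp
  have Psi_Y: "Psi ` ?Y \<subseteq> ?N"
  proof
    fix p assume "p \<in> Psi ` ?Y"
    then obtain x where "vadj E (u, l, 1) x" "p = Psi x" by blast
    then show "p \<in> ?N" using edge_in_V unfolding vadj_def by auto
  qed
  then have fin_Psi_Y: "finite (Psi ` ?Y)" using fin_N by (rule finite_subset)
  have factors: "\<And>x y. x \<in> ?Y \<Longrightarrow> y \<in> ?Y \<Longrightarrow> Psi x = Psi y \<Longrightarrow> cid x = cid y"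
    using cid_eq_if_Psi_eq by blast
  show "finite (adj_comps u)"
    unfolding adj_comps_def by (rule card_image_le_card_image(1)[OF fin_Psi_Y factors])
  have "card (adj_comps u) \<le> card (Psi ` ?Y)"
    unfolding adj_comps_def by (rule card_image_le_card_image(2)[OF fin_Psi_Y factors])
  also have "\<dots> \<le> card ?N" using fin_N Psi_Y by (rule card_mono)
  also have "\<dots> \<le> degree V E u + 1" unfolding degree_def using finite_V by (simp add: card_insert_if)
  also have "degree V E u \<le> max_degree V E"
    unfolding max_degree_def using finite_V assms by (intro Max_ge) auto
  finally show "card (adj_comps u) \<le> max_degree V E + 1" by simp
qed

lemma Union_run_helper_msg:
  assumes "max_degree V E + 1 \<le> r"
  shows "\<Union>(set (run E ident I helper_msg r u)) =
    {(ident w, encode (I w) c) | w c. E u w \<and> c \<in> adj_comps w}"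
proof -
  have "{m. \<exists>j<r. helper_msg (I w) (run E ident I helper_msg j w) = Some m} = encode (I w) ` adj_comps w"
    if "E u w" for w
    using helper_msgs_sent[of "I w" r] card_adj_comps_le[of w] edge_in_V[OF that] assms
    unfolding input_comps_local_input by simp
  then show ?thesis unfolding Union_run by blast
qed

lemma ident_neighbour_inj: "\<lbrakk>E u w; E u w'; ident w = ident w'\<rbrakk> \<Longrightarrow> w = w'"
  using edge_in_V inj_ident by (meson inj_onD)

context
  fixes u R
  assumes u: "u \<in> V" and R: "R = {(ident w, encode (I w) c) | w c. E u w \<and> c \<in> adj_comps w}"
begin

lemma received_from_iff: "E u w \<Longrightarrow> (ident w, m) \<in> R \<longleftrightarrow> (\<exists>c\<in>adj_comps w. m = encode (I w) c)"
  unfolding R using ident_neighbour_inj by blast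

lemma received_sender: "(s, m) \<in> R \<Longrightarrow> \<exists>w. E u w \<and> s = ident w"
  unfolding R by blast

lemma heard_comps_ident:
  assumes "E u w" shows "heard_comps R (ident w) = adj_comps w"
proof -
  have "heard_comps R (ident w) = (\<lambda>m. m div 2) ` encode (I w) ` adj_comps w"
    unfolding heard_comps_def using received_from_iff[OF assms] by blast
  then show ?thesis by (simp add: image_image)
qed

lemma heard_comps_other: "\<nexists>w. E u w \<and> s = ident w \<Longrightarrow> heard_comps R s = {}"
  unfolding heard_comps_def using received_sender by blast

lemma received_double_iff:
  "(s, 2 * c) \<in> R \<longleftrightarrow> (\<exists>w. E u w \<and> s = ident w \<and> c \<in> adj_comps w \<and> \<not> hosts w c)"
proof
  assume received: "(s, 2 * c) \<in> R"
  then obtain w where w: "E u w" "s = ident w" using received_sender by blast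
  with received obtain c' where c': "c' \<in> adj_comps w" "encode (I w) c' = 2 * c"
    using received_from_iff by auto
  have "w \<in> V" using edge_in_V w(1) by blast
  have "c = c'" "\<not> hosts w c'"
    using encode_eq_double_iff[of "I w" c' c] c'(2) input_hosts_local_input[OF \<open>w \<in> V\<close>] by simp_all
  with w c'(1) show "\<exists>w. E u w \<and> s = ident w \<and> c \<in> adj_comps w \<and> \<not> hosts w c" by blast
next
  assume "\<exists>w. E u w \<and> s = ident w \<and> c \<in> adj_comps w \<and> \<not> hosts w c"
  then obtain w where w: "E u w" "s = ident w" "c \<in> adj_comps w" "\<not> hosts w c" by blast
  have "w \<in> V" using edge_in_V w(1) by blast
  then have "encode (I w) c = 2 * c"
    using encode_eq_double_iff[of "I w" c c] input_hosts_local_input w(4) by simp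
  moreover have "(ident w, encode (I w) c) \<in> R" using received_from_iff[OF w(1)] w(3) by blast
  ultimately show "(s, 2 * c) \<in> R" using w(2) by simp
qed

lemma heard_type2_iff: "heard_type2 R s c \<longleftrightarrow> (\<exists>w. E u w \<and> s = ident w \<and> type2_helper w c)"
  unfolding heard_type2_def type2_helper_def received_double_iff using heard_comps_ident by auto

lemma receptive_heard_comps_iff:
  "receptive (heard_comps R s) c \<longleftrightarrow> (\<exists>w. E u w \<and> s = ident w \<and> receptive (adj_comps w) c)"
proof (cases "\<exists>w. E u w \<and> s = ident w")
  case True
  then obtain w where w: "E u w" "s = ident w" by blast
  then have "(\<exists>w'. E u w' \<and> s = ident w' \<and> receptive (adj_comps w') c) \<longleftrightarrow> receptive (adj_comps w) c"
    using ident_neighbour_inj by blast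
  then show ?thesis using heard_comps_ident[OF w(1)] w(2) by simp
next
  case False
  then show ?thesis using heard_comps_other[OF False] by (auto simp: receptive_def)
qed

lemma helper_out_eq_local_output:
  assumes "\<Union>(set h) = R"
  shows "helper_out (I u) h = local_output V E L l cls cid ident i u"
  unfolding helper_out_def Let_def assms local_output_eq[OF u] input_type2_local_input[OF u]
    input_comps_local_input heard_type2_iff receptive_heard_comps_iff
  by auto

end

lemma helper_msg_less:
  assumes "helper_msg (I u) h = Some m" and "\<forall>x\<in>old V L l. cid x < N"
  shows "m < 2 * N"
proof -
  obtain c where c: "c \<in> adj_comps u" "m = encode (I u) c"
    using helper_msg_SomeD[OF assms(1)] unfolding input_comps_local_input by blast
  then have "c < N" using assms(2) adj_comps_subset class_set_D by blast
  then show ?thesis using encode_le[of "I u" c] c(2) by linarith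
qed

lemma helper_out_correct:
  assumes "max_degree V E + 1 \<le> r" and "u \<in> V"
  shows "helper_out (I u) (run E ident I helper_msg r u) = local_output V E L l cls cid ident i u"
  using helper_out_eq_local_output[OF assms(2) refl Union_run_helper_msg[OF assms(1)]] .

lemma helper_protocol_correct:
  assumes "\<forall>x\<in>old V L l. cid x < (card V + 2) ^ k"
  shows "let I = local_input V E L l cls cid ident i in
    (\<forall>r. \<forall>u\<in>V. \<forall>m. helper_msg (I u) (run E ident I helper_msg r u) = Some m
        \<longrightarrow> m < (card V + 2) ^ Suc k) \<and>
    (\<forall>r \<ge> Suc k * (max_degree V E + 1). \<forall>u\<in>V.
        helper_out (I u) (run E ident I helper_msg r u) = local_output V E L l cls cid ident i u)"
  unfolding Let_def
proof (intro conjI allI ballI impI)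
  fix r u m assume "helper_msg (I u) (run E ident I helper_msg r u) = Some m"
  then have "m < 2 * (card V + 2) ^ k" using assms by (rule helper_msg_less)
  also have "\<dots> \<le> (card V + 2) ^ Suc k" by simp
  finally show "m < (card V + 2) ^ Suc k" .
next
  fix r u assume r: "Suc k * (max_degree V E + 1) \<le> r" and "u \<in> V"
  have "max_degree V E + 1 \<le> Suc k * (max_degree V E + 1)" by simp
  then have "max_degree V E + 1 \<le> r" using r by (rule le_trans)
  then show "helper_out (I u) (run E ident I helper_msg r u) = local_output V E L l cls cid ident i u"
    using \<open>u \<in> V\<close> by (rule helper_out_correct)
qed

end

theorem lemma5:
  "\<forall>k::nat. \<exists>(msg :: inp \<Rightarrow> hist \<Rightarrow> nat option) (out :: inp \<Rightarrow> hist \<Rightarrow> outp) (c::nat).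
     \<forall>(V :: 'v set) (E :: 'v \<Rightarrow> 'v \<Rightarrow> bool) (L::nat) (l::nat) (t::nat) (i::nat)
       (cls :: 'v vnode \<Rightarrow> nat) (cid :: 'v vnode \<Rightarrow> nat) (ident :: 'v \<Rightarrow> nat).
       finite V \<and>
       (\<forall>u w. E u w \<longrightarrow> u \<in> V \<and> w \<in> V \<and> u \<noteq> w \<and> E w u) \<and>
       L < l \<and> l \<le> 2 * L \<and> 1 \<le> i \<and> i \<le> t \<and>
       (\<forall>x \<in> old V L l. 1 \<le> cls x \<and> cls x \<le> t) \<and>
       (\<forall>x \<in> old V L l. \<forall>y \<in> old V L l. cls x = cls y \<longrightarrow>
          (cid x = cid y \<longleftrightarrow> y \<in> comp_in E (class_set V L l cls (cls x)) x)) \<and>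
       inj_on ident V \<and>
       t < (card V + 2) ^ k \<and>
       (\<forall>u \<in> V. ident u < (card V + 2) ^ k) \<and>
       (\<forall>x \<in> old V L l. cid x < (card V + 2) ^ k)
     \<longrightarrow>
       (let I = local_input V E L l cls cid ident i in
        (\<forall>r. \<forall>u \<in> V. \<forall>m. msg (I u) (run E ident I msg r u) = Some m
               \<longrightarrow> m < (card V + 2) ^ c) \<and>
        (\<forall>r \<ge> c * (max_degree V E + 1). \<forall>u \<in> V.
           out (I u) (run E ident I msg r u) = local_output V E L l cls cid ident i u))"
  (is "\<forall>k. \<exists>msg out c. ?correct k msg out c")
proof
  fix k
  have "?correct k helper_msg helper_out (Suc k)"
    by (intro allI impI, elim conjE, rule helper_setup.helper_protocol_correct, unfold_locales) (assumption | blast)+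
  then show "\<exists>msg out c. ?correct k msg out c" by blast
qed

end
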